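(* Let $(A,\langle\cdot,\cdot\rangle)$ be a finite-dimensional symmetric Frobenius algebra over a field $\mathbf{k}$ of characteristic zero, let $\mathcal R$ be a skew-symmetric Rota-Baxter operator on $(A,\langle\cdot,\cdot\rangle)$, and let $A_{\mathcal R}$ be the descendent associative algebra. For $p\ge0$, define $J_p:\mathrm{Hom}(A^{\otimes p},A)\to\mathrm{Hom}(A^{\otimes(p+1)},\mathbf{k})$ by $$J_p(F)(x_0,\dots,x_p):=\langle F(x_1,\dots,x_p),x_0\rangle.$$ Then $J_p$ is a vector space isomorphism and satisfies $J_{p+1}\circ d_H=d_C\circ J_p$. Consequently, $J_{p+1}\circ d_{\mathcal R}=(-1)^p\,d_C\circ J_p$. Moreover, $J_p$ restricts to an isomorphism $J_p:\mathrm{C}^p_{rb}(A)\to\mathrm{C}^p_\tau(A_{\mathcal R})$. For $p\ge0$, set $\widetilde J_p:=(-1)^{\frac{p(p-1)}2}J_p$. Then $$\widetilde J:(\mathrm{C}^\bullet_{rb}(A),d_{\mathcal R})\xrightarrow{\ \cong\ }(\mathrm{C}^\bullet_\tau(A_{\mathcal R}),d_C)$$ is an isomorphism of cochain complexes. Consequently, $$H^p_{rb,\mathrm{cyc}}(A,\mathcal R)\cong HC^p_\tau(A_{\mathcal R}),\qquad p\ge0.$$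
   Context: A symmetric Frobenius algebra is an associative algebra $A$ with a non-degenerate symmetric bilinear form with $\langle xy,z\rangle=\langle x,yz\rangle$. A Rota-Baxter operator is a linear map $\mathcal R:A\to A$ with $\mathcal R(x)\mathcal R(y)=\mathcal R(\mathcal R(x)y+x\mathcal R(y))$; it is skew-symmetric if $\langle\mathcal R(x),y\rangle=-\langle x,\mathcal R(y)\rangle$. The descendent algebra $A_{\mathcal R}$ is $A$ with the associative product $x\cdot_{\mathcal R}y=\mathcal R(x)y+x\mathcal R(y)$. **Rota-Baxter complex.** For $p\ge0$ (with $\mathrm{Hom}(A^{\otimes0},A)=A$), $\mathrm{C}^p_{rb}(A)$ is the space of $F\in\mathrm{Hom}(A^{\otimes p},A)$ with $\langle F(x_1,\dots,x_p),x_0\rangle=(-1)^p\langle F(x_0,\dots,x_{p-1}),x_p\rangle$ for all $x_i\in A$; $\mathrm C^\bullet_{rb}(A)=\bigoplus_{p\ge 0}\mathrm C^p_{rb}(A)$. The differential is $d_{\mathcal R}F=[\mathcal R,F]_{rb}$, where for $F,G$ of degrees $p,q\ge1$, $[F,G]_{rb}:=F\circledcirc G-(-1)^{pq}G\circledcirc F$ with $$\begin{aligned}(F\circledcirc G)(x_1,\dots,x_{p+q})=&\sum_{i=1}^p(-1)^{(i-1)q}F(x_1,\dots,x_{i-1},G(x_i,\dots,x_{i+q-1})x_{i+q},x_{i+q+1},\dots,x_{p+q})\\&-\sum_{i=1}^p(-1)^{iq}F(x_1,\dots,x_{i-1},x_iG(x_{i+1},\dots,x_{i+q}),x_{i+q+1},\dots,x_{p+q})\\&+(-1)^{pq}F(x_1,\dots,x_p)G(x_{p+1},\dots,x_{p+q}),\end{aligned}$$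 and for $a\in A$ and $F$ of degree $p\ge1$, $[F,a]_{rb}(x_1,\dots,x_p)=\sum_{i=1}^pF(x_1,\dots,ax_i-x_ia,\dots,x_p)+F(x_1,\dots,x_p)a-aF(x_1,\dots,x_p)$ (with $ax_i-x_ia$ in position $i$). $H^\bullet_{rb,\mathrm{cyc}}(A,\mathcal R)$ is the cohomology of $(\mathrm{C}^\bullet_{rb}(A),d_{\mathcal R})$, with $\mathrm{C}^{-1}_{rb}(A)=0$. **Hochschild differential $d_H$.** Let $M$ be $A$ with the $A_{\mathcal R}$-bimodule structure $l_{\mathcal R}(a)b=\mathcal R(a)b-\mathcal R(ab)$, $r_{\mathcal R}(a)b=b\mathcal R(a)-\mathcal R(ba)$. For $F\in\mathrm{Hom}(A_{\mathcal R}^{\otimes p},M)=\mathrm{Hom}(A^{\otimes p},A)$, $$(d_HF)(x_1,\dots,x_{p+1})=l_{\mathcal R}(x_1)F(x_2,\dots,x_{p+1})+\sum_{i=1}^p(-1)^iF(x_1,\dots,x_i\cdot_{\mathcal R}x_{i+1},\dots,x_{p+1})+(-1)^{p+1}r_{\mathcal R}(x_{p+1})F(x_1,\dots,x_p),$$ and for $p=0$, $(d_Ha)(x)=l_{\mathcal R}(x)a-r_{\mathcal R}(x)a$. **Cyclic complex.** For $F\in\mathrm{Hom}(A_{\mathcal R}^{\otimes(p+1)},\mathbf{k})$, $$(d_CF)(x_0,\dots,x_{p+1})=\sum_{i=0}^p(-1)^iF(x_0,\dots,x_i\cdot_{\mathcal R}x_{i+1},\dots,x_{p+1})+(-1)^{p+1}F(x_{p+1}\cdot_{\mathcal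 R}x_0,x_1,\dots,x_p).$$ Put $(\tau_pF)(x_0,\dots,x_p)=(-1)^pF(x_p,x_0,\dots,x_{p-1})$ and $\mathrm{C}^p_\tau(A_{\mathcal R})=\ker(1-\tau_p)\subseteq\mathrm{Hom}(A_{\mathcal R}^{\otimes(p+1)},\mathbf{k})$; $\mathrm C^\bullet_\tau(A_{\mathcal R})=\bigoplus_{p\ge0}\mathrm C^p_\tau(A_{\mathcal R})$ is a subcomplex under $d_C$, and $HC^p_\tau(A_{\mathcal R}):=H^p(\mathrm{C}^\bullet_\tau(A_{\mathcal R}),d_C)$. *)

theory Defs
  imports Complex_Main "HOL-Library.Function_Algebras" "HOL-Library.Set_Algebras"
begin

section \<open>Symmetric Frobenius algebras and Rota-Baxter operators\<close>

text \<open>The class \<open>ring\<close> provides associative rings without a unit; no unit is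
  assumed, and the descendent algebra below has none in general.\<close>

locale assoc_algebra = vector_space scale
  for scale :: "'k::field \<Rightarrow> 'a::ring \<Rightarrow> 'a" +
  assumes scale_mult_left: "scale c x * y = scale c (x * y)"
    and scale_mult_right: "x * scale c y = scale c (x * y)"

locale symmetric_frobenius_algebra = assoc_algebra scale
  for scale :: "'k::field \<Rightarrow> 'a::ring \<Rightarrow> 'a" +
  fixes form :: "'a \<Rightarrow> 'a \<Rightarrow> 'k"
  assumes form_linear_left: "Vector_Spaces.linear scale times (\<lambda>x. form x y)"
    and form_linear_right: "Vector_Spaces.linear scale times (\<lambda>y. form x y)"
    and form_sym: "form x y = form y x"
    and form_invariant: "form (x * y) z = form x (y * z)"
    and form_nondegenerate: "(\<And>y. form x y = 0) \<Longrightarrow> x = 0"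

definition rota_baxter_operator ::
  "('k::field \<Rightarrow> 'a::ring \<Rightarrow> 'a) \<Rightarrow> ('a \<Rightarrow> 'a) \<Rightarrow> bool" where
  "rota_baxter_operator scale R \<longleftrightarrow>
     Vector_Spaces.linear scale scale R \<and> (\<forall>x y. R x * R y = R (R x * y + x * R y))"

definition skew_symmetric_operator ::
  "('a \<Rightarrow> 'a \<Rightarrow> 'k::field) \<Rightarrow> ('a::ring \<Rightarrow> 'a) \<Rightarrow> bool" where
  "skew_symmetric_operator form R \<longleftrightarrow> (\<forall>x y. form (R x) y = - form x (R y))"

definition descendent_mult :: "('a::ring \<Rightarrow> 'a) \<Rightarrow> 'a \<Rightarrow> 'a \<Rightarrow> 'a" where
  "descendent_mult R x y = R x * y + x * R y"

lemma descendent_mult_assoc: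
  assumes "rota_baxter_operator scale R"
  shows "descendent_mult R (descendent_mult R x y) z = descendent_mult R x (descendent_mult R y z)"
proof -
  have "\<And>x y. R (R x * y + x * R y) = R x * R y"
    using assms by (simp add: rota_baxter_operator_def)
  then show ?thesis
    by (simp add: descendent_mult_def algebra_simps)
qed


section \<open>Vector spaces of multilinear maps\<close>

definition fscale :: "('k \<Rightarrow> 'w \<Rightarrow> 'w) \<Rightarrow> 'k \<Rightarrow> ('b \<Rightarrow> 'w) \<Rightarrow> 'b \<Rightarrow> 'w" where
  "fscale s c F = (\<lambda>x. s c (F x))"

lemma vector_space_fscale:
  fixes s :: "'k::field \<Rightarrow> 'w::ab_group_add \<Rightarrow> 'w"
  assumes "vector_space s"
  shows "vector_space (fscale s :: 'k \<Rightarrow> ('b \<Rightarrow> 'w) \<Rightarrow> 'b \<Rightarrow> 'w)"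
  using assms by (simp add: vector_space_def fscale_def fun_eq_iff)

text \<open>\<open>multilinear_maps s t n\<close> is $\mathrm{Hom}(A^{\otimes n}, W)$, an $n$-linear map being
  a function of the list of its $n$ arguments.  Its value on lists of any other length is
  fixed to be 0, so that equality of functions is equality of multilinear maps.  An element
  of \<open>multilinear_maps s t 0\<close> amounts to its value at the empty list.\<close>

definition multilinear_maps ::
  "('k::field \<Rightarrow> 'a::ab_group_add \<Rightarrow> 'a) \<Rightarrow> ('k \<Rightarrow> 'w::ab_group_add \<Rightarrow> 'w) \<Rightarrow> nat \<Rightarrow>
   ('a list \<Rightarrow> 'w) set" where
  "multilinear_maps s t n = {F.
     (\<forall>xs. length xs \<noteq> n \<longrightarrow> F xs = 0) \<and>
     (\<forall>xs i. length xs = n \<and> i < n \<longrightarrow> Vector_Spaces.linear s t (\<lambda>x. F (xs[i := x])))}"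


section \<open>Cochain complexes of subspaces and their cohomology\<close>

definition linear_map_on ::
  "('k \<Rightarrow> 'v::ab_group_add \<Rightarrow> 'v) \<Rightarrow> ('k \<Rightarrow> 'w::ab_group_add \<Rightarrow> 'w) \<Rightarrow>
   'v set \<Rightarrow> 'w set \<Rightarrow> ('v \<Rightarrow> 'w) \<Rightarrow> bool" where
  "linear_map_on s t V W f \<longleftrightarrow> f ` V \<subseteq> W \<and>
     (\<forall>x\<in>V. \<forall>y\<in>V. f (x + y) = f x + f y) \<and> (\<forall>c. \<forall>x\<in>V. f (s c x) = t c (f x))"

definition linear_iso_on ::
  "('k::field \<Rightarrow> 'v::ab_group_add \<Rightarrow> 'v) \<Rightarrow> ('k \<Rightarrow> 'w::ab_group_add \<Rightarrow> 'w) \<Rightarrow>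
   'v set \<Rightarrow> 'w set \<Rightarrow> ('v \<Rightarrow> 'w) \<Rightarrow> bool" where
  "linear_iso_on s t V W f \<longleftrightarrow>
     module.subspace s V \<and> module.subspace t W \<and> linear_map_on s t V W f \<and> bij_betw f V W"

text \<open>A complex $\bigoplus_{p\ge 0} C^p$ is given by its homogeneous components, subspaces of a
  common ambient space with scalar multiplication \<open>s\<close>.\<close>

definition cochain_complex ::
  "('k::field \<Rightarrow> 'v::ab_group_add \<Rightarrow> 'v) \<Rightarrow> (nat \<Rightarrow> 'v set) \<Rightarrow> (nat \<Rightarrow> 'v \<Rightarrow> 'v) \<Rightarrow> bool" where
  "cochain_complex s C d \<longleftrightarrow>
     (\<forall>p. module.subspace s (C p)) \<and>
     (\<forall>p. linear_map_on s s (C p) (C (p + 1)) (d p)) \<and>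
     (\<forall>p. \<forall>x\<in>C p. d (p + 1) (d p x) = 0)"

definition cochain_iso ::
  "('k::field \<Rightarrow> 'v::ab_group_add \<Rightarrow> 'v) \<Rightarrow> (nat \<Rightarrow> 'v set) \<Rightarrow> (nat \<Rightarrow> 'v \<Rightarrow> 'v) \<Rightarrow>
   ('k \<Rightarrow> 'w::ab_group_add \<Rightarrow> 'w) \<Rightarrow> (nat \<Rightarrow> 'w set) \<Rightarrow> (nat \<Rightarrow> 'w \<Rightarrow> 'w) \<Rightarrow>
   (nat \<Rightarrow> 'v \<Rightarrow> 'w) \<Rightarrow> bool" where
  "cochain_iso s C d t D e f \<longleftrightarrow>
     cochain_complex s C d \<and> cochain_complex t D e \<and>
     (\<forall>p. linear_iso_on s t (C p) (D p) (f p)) \<and>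
     (\<forall>p. \<forall>x\<in>C p. f (p + 1) (d p x) = e p (f p x))"

definition cocycles ::
  "(nat \<Rightarrow> 'v::ab_group_add set) \<Rightarrow> (nat \<Rightarrow> 'v \<Rightarrow> 'v) \<Rightarrow> nat \<Rightarrow> 'v set" where
  "cocycles C d p = {z \<in> C p. d p z = 0}"

definition coboundaries ::
  "(nat \<Rightarrow> 'v::ab_group_add set) \<Rightarrow> (nat \<Rightarrow> 'v \<Rightarrow> 'v) \<Rightarrow> nat \<Rightarrow> 'v set" where
  "coboundaries C d p = (if p = 0 then {0} else d (p - 1) ` C (p - 1))"

definition cohomology ::
  "(nat \<Rightarrow> 'v::ab_group_add set) \<Rightarrow> (nat \<Rightarrow> 'v \<Rightarrow> 'v) \<Rightarrow> nat \<Rightarrow> 'v set set" where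
  "cohomology C d p = (\<lambda>z. z +o coboundaries C d p) ` cocycles C d p"

text \<open>The vector space structure on a quotient by the subspace \<open>B\<close>: the sum of the cosets
  \<open>X\<close>, \<open>Y\<close> is the elementwise sum \<open>X + Y\<close>, and the scalar multiple is as follows; adding
  \<open>B\<close> matters only for \<open>c = 0\<close>, where \<open>s c ` X\<close> is \<open>{0}\<close> rather than the coset \<open>B\<close>.\<close>

definition coset_scale ::
  "('k \<Rightarrow> 'v::ab_group_add \<Rightarrow> 'v) \<Rightarrow> 'v set \<Rightarrow> 'k \<Rightarrow> 'v set \<Rightarrow> 'v set" where
  "coset_scale s B c X = s c ` X + B"

definition cohomology_isomorphic ::
  "('k::field \<Rightarrow> 'v::ab_group_add \<Rightarrow> 'v) \<Rightarrow> (nat \<Rightarrow> 'v set) \<Rightarrow> (nat \<Rightarrow> 'v \<Rightarrow> 'v) \<Rightarrow>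
   ('k \<Rightarrow> 'w::ab_group_add \<Rightarrow> 'w) \<Rightarrow> (nat \<Rightarrow> 'w set) \<Rightarrow> (nat \<Rightarrow> 'w \<Rightarrow> 'w) \<Rightarrow> nat \<Rightarrow> bool" where
  "cohomology_isomorphic s C d t D e p \<longleftrightarrow>
     (\<exists>\<phi>. bij_betw \<phi> (cohomology C d p) (cohomology D e p) \<and>
        (\<forall>X\<in>cohomology C d p. \<forall>Y\<in>cohomology C d p. \<phi> (X + Y) = \<phi> X + \<phi> Y) \<and>
        (\<forall>c. \<forall>X\<in>cohomology C d p.
           \<phi> (coset_scale s (coboundaries C d p) c X) =
           coset_scale t (coboundaries D e p) c (\<phi> X)))"


section \<open>The Rota-Baxter complex\<close>

text \<open>In this section a list \<open>xs\<close> stands for $x_1,\dots,x_n$, so that $x_j$ is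
  \<open>xs ! (j - 1)\<close>, and $x_j,\dots,x_{j+m-1}$ is \<open>take m (drop (j - 1) xs)\<close>.\<close>

definition rb_circ ::
  "('k::field \<Rightarrow> 'a::ring \<Rightarrow> 'a) \<Rightarrow> nat \<Rightarrow> nat \<Rightarrow> ('a list \<Rightarrow> 'a) \<Rightarrow> ('a list \<Rightarrow> 'a) \<Rightarrow>
   'a list \<Rightarrow> 'a" where
  "rb_circ scale p q F G xs = (if length xs = p + q then
      (\<Sum>i=1..p. scale ((-1) ^ ((i - 1) * q))
         (F (take (i - 1) xs @ [G (take q (drop (i - 1) xs)) * xs ! (i + q - 1)] @ drop (i + q) xs)))
    - (\<Sum>i=1..p. scale ((-1) ^ (i * q))
         (F (take (i - 1) xs @ [xs ! (i - 1) * G (take q (drop i xs))] @ drop (i + q) xs)))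
    + scale ((-1) ^ (p * q)) (F (take p xs) * G (drop p xs))
    else 0)"

definition rb_bracket ::
  "('k::field \<Rightarrow> 'a::ring \<Rightarrow> 'a) \<Rightarrow> nat \<Rightarrow> nat \<Rightarrow> ('a list \<Rightarrow> 'a) \<Rightarrow> ('a list \<Rightarrow> 'a) \<Rightarrow>
   'a list \<Rightarrow> 'a" where
  "rb_bracket scale p q F G xs =
     rb_circ scale p q F G xs - scale ((-1) ^ (p * q)) (rb_circ scale q p G F xs)"

definition rb_bracket_elem :: "nat \<Rightarrow> ('a::ring list \<Rightarrow> 'a) \<Rightarrow> 'a \<Rightarrow> 'a list \<Rightarrow> 'a" where
  "rb_bracket_elem p F a xs = (if length xs = p then
      (\<Sum>i=1..p. F (xs[i - 1 := a * xs ! (i - 1) - xs ! (i - 1) * a])) + F xs * a - a * F xs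
    else 0)"

definition unary_cochain :: "('a \<Rightarrow> 'a::zero) \<Rightarrow> 'a list \<Rightarrow> 'a" where
  "unary_cochain R xs = (if length xs = 1 then R (hd xs) else 0)"

definition rb_diff ::
  "('k::field \<Rightarrow> 'a::ring \<Rightarrow> 'a) \<Rightarrow> ('a \<Rightarrow> 'a) \<Rightarrow> nat \<Rightarrow> ('a list \<Rightarrow> 'a) \<Rightarrow> 'a list \<Rightarrow> 'a" where
  "rb_diff scale R p F =
     (if p = 0 then rb_bracket_elem 1 (unary_cochain R) (F [])
      else rb_bracket scale 1 p (unary_cochain R) F)"

text \<open>Here \<open>xs\<close> is $x_0,\dots,x_p$.\<close>

definition rb_cochains ::
  "('k::field \<Rightarrow> 'a::ring \<Rightarrow> 'a) \<Rightarrow> ('a \<Rightarrow> 'a \<Rightarrow> 'k) \<Rightarrow> nat \<Rightarrow> ('a list \<Rightarrow> 'a) set" where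
  "rb_cochains scale form p = {F \<in> multilinear_maps scale scale p.
     \<forall>xs. length xs = p + 1 \<longrightarrow>
       form (F (tl xs)) (hd xs) = (-1) ^ p * form (F (butlast xs)) (last xs)}"


section \<open>Hochschild and cyclic differentials\<close>

text \<open>Multiplies the entries at the (0-based) positions \<open>j\<close> and \<open>j + 1\<close>.\<close>

definition merge_at :: "('a \<Rightarrow> 'a \<Rightarrow> 'a) \<Rightarrow> nat \<Rightarrow> 'a list \<Rightarrow> 'a list" where
  "merge_at mul j xs = take j xs @ [mul (xs ! j) (xs ! (j + 1))] @ drop (j + 2) xs"

text \<open>Here \<open>xs\<close> is $x_1,\dots,x_{p+1}$; the formula for $p = 0$ is the instance with empty sum.\<close>

definition hochschild_diff ::
  "('k::field \<Rightarrow> 'w::ab_group_add \<Rightarrow> 'w) \<Rightarrow> ('a \<Rightarrow> 'a \<Rightarrow> 'a) \<Rightarrow> ('a \<Rightarrow> 'w \<Rightarrow> 'w) \<Rightarrow> ('a \<Rightarrow> 'w \<Rightarrow> 'w) \<Rightarrow>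
   nat \<Rightarrow> ('a list \<Rightarrow> 'w) \<Rightarrow> 'a list \<Rightarrow> 'w" where
  "hochschild_diff t mul l r p F xs = (if length xs = p + 1 then
      l (hd xs) (F (tl xs))
    + (\<Sum>i=1..p. t ((-1) ^ i) (F (merge_at mul (i - 1) xs)))
    + t ((-1) ^ (p + 1)) (r (last xs) (F (butlast xs)))
    else 0)"

definition rb_left_action :: "('a::ring \<Rightarrow> 'a) \<Rightarrow> 'a \<Rightarrow> 'a \<Rightarrow> 'a" where
  "rb_left_action R a b = R a * b - R (a * b)"

definition rb_right_action :: "('a::ring \<Rightarrow> 'a) \<Rightarrow> 'a \<Rightarrow> 'a \<Rightarrow> 'a" where
  "rb_right_action R a b = b * R a - R (b * a)"

definition rb_hochschild_diff ::
  "('k::field \<Rightarrow> 'a::ring \<Rightarrow> 'a) \<Rightarrow> ('a \<Rightarrow> 'a) \<Rightarrow> nat \<Rightarrow> ('a list \<Rightarrow> 'a) \<Rightarrow> 'a list \<Rightarrow> 'a" where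
  "rb_hochschild_diff scale R =
     hochschild_diff scale (descendent_mult R) (rb_left_action R) (rb_right_action R)"

text \<open>Below, \<open>xs\<close> is $x_0,\dots,x_{p+1}$ in the differential and $x_0,\dots,x_p$ in the
  cyclic operator.\<close>

definition cyclic_diff ::
  "('a \<Rightarrow> 'a \<Rightarrow> 'a) \<Rightarrow> nat \<Rightarrow> ('a list \<Rightarrow> 'k::field) \<Rightarrow> 'a list \<Rightarrow> 'k" where
  "cyclic_diff mul p F xs = (if length xs = p + 2 then
      (\<Sum>i=0..p. (-1) ^ i * F (merge_at mul i xs))
    + (-1) ^ (p + 1) * F (mul (last xs) (hd xs) # butlast (tl xs))
    else 0)"

definition cyclic_op :: "nat \<Rightarrow> ('a list \<Rightarrow> 'k::field) \<Rightarrow> 'a list \<Rightarrow> 'k" where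
  "cyclic_op p F xs = (if length xs = p + 1 then (-1) ^ p * F (last xs # butlast xs) else 0)"

definition cyclic_cochains ::
  "('k::field \<Rightarrow> 'a::ab_group_add \<Rightarrow> 'a) \<Rightarrow> nat \<Rightarrow> ('a list \<Rightarrow> 'k) set" where
  "cyclic_cochains scale p = {F \<in> multilinear_maps scale times (p + 1). F - cyclic_op p F = 0}"


section \<open>The comparison map\<close>

definition J_map ::
  "('a \<Rightarrow> 'a \<Rightarrow> 'k::field) \<Rightarrow> nat \<Rightarrow> ('a list \<Rightarrow> 'a) \<Rightarrow> 'a list \<Rightarrow> 'k" where
  "J_map form p F xs = (if length xs = p + 1 then form (F (tl xs)) (hd xs) else 0)"

definition J_tilde ::
  "('a \<Rightarrow> 'a \<Rightarrow> 'k::field) \<Rightarrow> nat \<Rightarrow> ('a list \<Rightarrow> 'a) \<Rightarrow> 'a list \<Rightarrow> 'k" where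
  "J_tilde form p F = fscale times ((-1) ^ (p * (p - 1) div 2)) (J_map form p F)"

end

theory Submission
  imports Defs
begin

text \<open>The form turns an \<open>A\<close>-valued cochain into a scalar one with an additional
  argument \<open>x\<^sub>0\<close>.  Non-degeneracy makes this faithful, and in finite dimension every functional
  is \<open>form a\<close> for some \<open>a\<close> (\<open>form_represents\<close>), so every scalar multilinear map arises; that is
  the isomorphism \<open>J_map\<close>.  Under it, the symmetry condition that singles out Rota-Baxter
  cochains is the eigenvector condition for the cyclic rotation, read off directly.

  The differentials match because the bimodule structure on \<open>A\<close> is adjoint to descendent
  multiplication.  Moving \<open>R\<close> across the form costs a sign, which the definition of the
  actions absorbs, so that \<open>\<langle>l(a) b, c\<rangle> = \<langle>b, c \<cdot> a\<rangle>\<close> and \<open>\<langle>r(a) b, c\<rangle> = \<langle>b, a \<cdot> c\<rangle>\<close>, where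
  \<open>\<cdot>\<close> is the descendent product.  The two outer terms of the Hochschild differential become the
  first and the wrap-around term of the cyclic one (\<open>J_map_rb_hochschild_diff\<close>), while the inner
  terms agree literally.  Expanding the bracket \<open>[R, F]\<close> gives \<open>(-1)^p\<close> times the Hochschild
  differential (\<open>rb_diff_eq_rb_hochschild_diff\<close>); the sign \<open>(-1)^(p (p - 1) / 2)\<close> in \<open>J_tilde\<close>
  compensates, since its exponent grows by \<open>p\<close> from degree \<open>p\<close> to degree \<open>p + 1\<close>.

  It remains to see that both sides are complexes.  On the cyclic side this is the classical
  argument: the face maps of cyclic words satisfy the simplicial identities by associativity
  (\<open>cyclic_face_cyclic_face\<close>) and commute with rotation up to a shift of the index
  (\<open>cyclic_face_rotate_right\<close>).  The Rota-Baxter side needs no computation: its differential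
  preserves the cochains, is linear and squares to zero because this can be tested after applying
  the injective map \<open>J_map\<close> (\<open>rb_diff_mem_rb_cochains\<close>, \<open>cochain_iso_transfer\<close>).\<close>

section \<open>Cochain complexes\<close>

lemma vector_space_times: "vector_space (times :: 'k::field \<Rightarrow> 'k \<Rightarrow> 'k)"
  by unfold_locales (simp_all add: algebra_simps)

lemma linear_map_onD:
  assumes "linear_map_on s t V W f"
  shows "x \<in> V \<Longrightarrow> f x \<in> W"
    and "x \<in> V \<Longrightarrow> y \<in> V \<Longrightarrow> f (x + y) = f x + f y"
    and "x \<in> V \<Longrightarrow> f (s c x) = t c (f x)"
  using assms by (auto simp: linear_map_on_def)

lemma linear_map_on_zero:
  assumes "linear_map_on s t V W f" "0 \<in> V"
  shows "f 0 = 0"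
  using linear_map_onD(2)[OF assms(1) assms(2) assms(2)] by simp

text \<open>Linearity of \<open>d\<close> and \<open>d d = 0\<close> are equations in some \<open>C q\<close>, so they can be checked after
  applying the injective map \<open>f q\<close>, where they become the corresponding equations for \<open>e\<close>.
  Only stability of \<open>C\<close> under \<open>d\<close> has to be known beforehand, so that injectivity applies.\<close>

lemma cochain_iso_transfer:
  fixes s :: "'k::field \<Rightarrow> 'v::ab_group_add \<Rightarrow> 'v" and t :: "'k \<Rightarrow> 'w::ab_group_add \<Rightarrow> 'w"
  assumes s: "vector_space s" and t: "vector_space t"
    and E: "cochain_complex t D e"
    and f: "\<And>p. linear_iso_on s t (C p) (D p) (f p)"
    and d: "\<And>p x. x \<in> C p \<Longrightarrow> d p x \<in> C (p + 1)"
    and fd: "\<And>p x. x \<in> C p \<Longrightarrow> f (p + 1) (d p x) = e p (f p x)"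
  shows "cochain_iso s C d t D e f"
proof -
  interpret s: vector_space s by fact
  interpret t: vector_space t by fact
  have sub: "s.subspace (C p)" for p
    using f[of p] by (simp add: linear_iso_on_def)
  have lin: "linear_map_on s t (C p) (D p) (f p)" for p
    using f[of p] by (simp add: linear_iso_on_def)
  have inj: "x = y" if "f p x = f p y" "x \<in> C p" "y \<in> C p" for p x y
    using f[of p] that by (auto simp: linear_iso_on_def bij_betw_def inj_on_def)
  have e: "linear_map_on t t (D p) (D (p + 1)) (e p)" for p
    using E by (simp add: cochain_complex_def)
  note fl = linear_map_onD[OF lin] and el = linear_map_onD[OF e]
  have "d p (x + y) = d p x + d p y" if "x \<in> C p" "y \<in> C p" for p x y
    by (rule inj[of "p + 1"])
      (simp_all only: that d fd fl el s.subspace_add[OF sub])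
  moreover have "d p (s c x) = s c (d p x)" if "x \<in> C p" for p c x
    by (rule inj[of "p + 1"])
      (simp_all only: that d fd fl el s.subspace_scale[OF sub])
  moreover have "d (p + 1) (d p x) = 0" if x: "x \<in> C p" for p x
  proof (rule inj[of "p + 1 + 1"])
    have "e (p + 1) (e p (f p x)) = 0"
      using E fl(1)[OF x] by (simp add: cochain_complex_def)
    then show "f (p + 1 + 1) (d (p + 1) (d p x)) = f (p + 1 + 1) 0"
      by (simp only: x d fd linear_map_on_zero[OF lin s.subspace_0[OF sub]])
  qed (simp_all only: x d s.subspace_0[OF sub])
  ultimately have "cochain_complex s C d"
    using sub d by (auto simp: cochain_complex_def linear_map_on_def)
  then show ?thesis
    using E f fd by (simp add: cochain_iso_def)
qed

text \<open>A cohomology class is literally a coset, so the induced isomorphism is the direct image of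
  sets under \<open>f p\<close>: it carries cocycles onto cocycles, coboundaries onto coboundaries, and
  respects elementwise sums of subsets of \<open>C p\<close>.\<close>

lemma cohomology_isomorphic_of_cochain_iso:
  fixes s :: "'k::field \<Rightarrow> 'v::ab_group_add \<Rightarrow> 'v" and t :: "'k \<Rightarrow> 'w::ab_group_add \<Rightarrow> 'w"
  assumes s: "vector_space s" and t: "vector_space t"
    and iso: "cochain_iso s C d t D e f"
  shows "cohomology_isomorphic s C d t D e p"
proof -
  interpret s: vector_space s by fact
  interpret t: vector_space t by fact
  have cC: "cochain_complex s C d" and cD: "cochain_complex t D e"
    and f: "\<And>p. linear_iso_on s t (C p) (D p) (f p)"
    and fd: "\<And>p x. x \<in> C p \<Longrightarrow> f (p + 1) (d p x) = e p (f p x)"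
    using iso by (auto simp: cochain_iso_def)
  have sub: "s.subspace (C p)" for p
    using f[of p] by (simp add: linear_iso_on_def)
  have lin: "linear_map_on s t (C p) (D p) (f p)" for p
    using f[of p] by (simp add: linear_iso_on_def)
  have inj: "inj_on (f p) (C p)" and img: "f p ` C p = D p" for p
    using f[of p] by (auto simp: linear_iso_on_def bij_betw_def)
  have dlin: "linear_map_on s s (C p) (C (p + 1)) (d p)" for p
    using cC by (simp add: cochain_complex_def)
  note fl = linear_map_onD[OF lin]
  have f0: "f p 0 = 0" for p
    by (rule linear_map_on_zero[OF lin s.subspace_0[OF sub]])
  let ?Z = "cocycles C d p" and ?Z' = "cocycles D e p"
  let ?B = "coboundaries C d p" and ?B' = "coboundaries D e p"
  have ZC: "?Z \<subseteq> C p" by (auto simp: cocycles_def)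
  have BC: "?B \<subseteq> C p"
  proof (cases p)
    case 0
    then show ?thesis using s.subspace_0[OF sub] by (simp add: coboundaries_def)
  next
    case (Suc q)
    then show ?thesis using linear_map_onD(1)[OF dlin[of q]] by (auto simp: coboundaries_def)
  qed
  have fZ: "f p ` ?Z = ?Z'"
  proof (intro equalityI subsetI)
    fix y assume "y \<in> f p ` ?Z"
    then show "y \<in> ?Z'"
      using fl(1) fd[symmetric] f0[of "p + 1"] by (auto simp: cocycles_def)
  next
    fix y assume y: "y \<in> ?Z'"
    then obtain x where x: "x \<in> C p" "y = f p x"
      using img[of p] by (auto simp: cocycles_def)
    then have "f (p + 1) (d p x) = f (p + 1) 0"
      using y fd f0[of "p + 1"] by (simp add: cocycles_def)
    then have "d p x = 0"
      using inj[of "p + 1"] x linear_map_onD(1)[OF dlin] s.subspace_0[OF sub]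
      by (auto simp: inj_on_def)
    then show "y \<in> f p ` ?Z" using x by (auto simp: cocycles_def)
  qed
  have fB: "f p ` ?B = ?B'"
  proof (cases p)
    case 0
    then show ?thesis using f0[of 0] by (simp add: coboundaries_def)
  next
    case (Suc q)
    have "f p ` d q ` C q = e q ` f q ` C q"
      using fd[of _ q] Suc by (simp add: image_image)
    then show ?thesis using Suc img[of q] by (simp add: coboundaries_def)
  qed
  have coset: "f p ` (z +o ?B) = f p z +o ?B'" if "z \<in> C p" for z
    using that fl(2) BC unfolding fB[symmetric] elt_set_plus_def by (force simp: image_iff)
  \<comment> \<open>The map is additive on \<open>C p\<close> only, hence the restriction on \<open>X\<close> and \<open>Y\<close>.\<close>
  have sum: "f p ` (X + Y) = f p ` X + f p ` Y" if "X \<subseteq> C p" "Y \<subseteq> C p" for X Y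
  proof
    show "f p ` (X + Y) \<subseteq> f p ` X + f p ` Y"
    proof
      fix u assume "u \<in> f p ` (X + Y)"
      then obtain x y where "x \<in> X" "y \<in> Y" "u = f p (x + y)" by (auto elim!: set_plus_elim)
      moreover have "x \<in> C p" "y \<in> C p" using that \<open>x \<in> X\<close> \<open>y \<in> Y\<close> by auto
      ultimately show "u \<in> f p ` X + f p ` Y" by (simp add: fl(2) set_plus_intro)
    qed
    show "f p ` X + f p ` Y \<subseteq> f p ` (X + Y)"
    proof
      fix u assume "u \<in> f p ` X + f p ` Y"
      then obtain x y where "x \<in> X" "y \<in> Y" "u = f p x + f p y" by (auto elim!: set_plus_elim)
      moreover have "x \<in> C p" "y \<in> C p" using that \<open>x \<in> X\<close> \<open>y \<in> Y\<close> by auto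
      ultimately show "u \<in> f p ` (X + Y)"
        by (intro image_eqI[of _ _ "x + y"]) (simp_all add: fl(2) set_plus_intro)
    qed
  qed
  have HC: "X \<subseteq> C p" if "X \<in> cohomology C d p" for X
  proof -
    from that obtain z where "z \<in> ?Z" "X = z +o ?B" by (auto simp: cohomology_def)
    then show ?thesis
      using ZC BC by (auto simp: elt_set_plus_def intro!: s.subspace_add[OF sub])
  qed
  have "inj_on ((`) (f p)) (cohomology C d p)"
    using inj_on_image_eq_iff[OF inj[of p]] HC by (auto simp: inj_on_def)
  moreover have "(`) (f p) ` cohomology C d p = cohomology D e p"
    unfolding cohomology_def fZ[symmetric] image_image
    by (intro image_cong refl) (use coset ZC in blast)
  moreover have "f p ` (X + Y) = f p ` X + f p ` Y"
    if "X \<in> cohomology C d p" "Y \<in> cohomology C d p" for X Y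
    by (intro sum HC that)
  moreover have "f p ` coset_scale s ?B c X = coset_scale t ?B' c (f p ` X)"
    if "X \<in> cohomology C d p" for c X
  proof -
    have X: "X \<subseteq> C p" by (rule HC[OF that])
    then have "s c ` X \<subseteq> C p" using s.subspace_scale[OF sub] by blast
    moreover have "f p ` s c ` X = t c ` f p ` X"
      unfolding image_image using X fl(3) by (intro image_cong) auto
    ultimately show ?thesis
      using sum[OF _ BC] by (simp add: coset_scale_def fB)
  qed
  ultimately show ?thesis
    unfolding cohomology_isomorphic_def bij_betw_def
    by (intro exI[of _ "(`) (f p)"] conjI ballI allI)
qed


section \<open>The cyclic complex of an associative algebra\<close>

text \<open>The faces of a word \<open>x\<^sub>0, \<dots>, x\<^sub>n\<close> read cyclically: face \<open>i < n\<close> multiplies \<open>x\<^sub>i x\<^sub>i\<^sub>+\<^sub>1\<close>, and the last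
  face multiplies \<open>x\<^sub>n x\<^sub>0\<close>.  Writing the latter as a rotation followed by face 0 reduces every
  identity that involves it to identities between ordinary merges and rotations.\<close>

definition rotate_right :: "'a list \<Rightarrow> 'a list" where
  "rotate_right xs = last xs # butlast xs"

definition cyclic_face :: "('a \<Rightarrow> 'a \<Rightarrow> 'a) \<Rightarrow> nat \<Rightarrow> 'a list \<Rightarrow> 'a list" where
  "cyclic_face mul i xs =
     (if i + 1 < length xs then merge_at mul i xs else merge_at mul 0 (rotate_right xs))"

lemma length_merge_at: "j + 1 < length xs \<Longrightarrow> length (merge_at mul j xs) = length xs - 1"
  by (simp add: merge_at_def)

lemma nth_merge_at:
  assumes "j + 1 < length xs" "k + 1 < length xs"
  shows "merge_at mul j xs ! k =
    (if k < j then xs ! k else if k = j then mul (xs ! j) (xs ! (j + 1)) else xs ! (k + 1))"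
  using assms by (auto simp: merge_at_def nth_append nth_Cons')

lemma length_rotate_right: "xs \<noteq> [] \<Longrightarrow> length (rotate_right xs) = length xs"
  by (simp add: rotate_right_def)

lemma nth_rotate_right:
  "k < length xs \<Longrightarrow> rotate_right xs ! k = (if k = 0 then xs ! (length xs - 1) else xs ! (k - 1))"
  by (cases "xs = []") (auto simp: rotate_right_def nth_Cons' nth_butlast last_conv_nth)

lemma length_cyclic_face: "2 \<le> length xs \<Longrightarrow> length (cyclic_face mul i xs) = length xs - 1"
  by (subgoal_tac "xs \<noteq> []") (auto simp: cyclic_face_def length_merge_at length_rotate_right)

lemma merge_at_merge_at:
  assumes assoc: "\<And>x y z. mul (mul x y) z = mul x (mul y z)"
    and "i < j" "j + 1 < length xs"
  shows "merge_at mul i (merge_at mul j xs) = merge_at mul (j - 1) (merge_at mul i xs)"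
proof (rule nth_equalityI)
  show "length (merge_at mul i (merge_at mul j xs)) = length (merge_at mul (j - 1) (merge_at mul i xs))"
    using assms(2,3) by (simp add: length_merge_at)
  fix k assume "k < length (merge_at mul i (merge_at mul j xs))"
  then have k: "k + 2 < length xs" using assms(2,3) by (simp add: length_merge_at)
  consider "k < i" | "k = i" "j = i + 1" | "k = i" "i + 1 < j" | "i < k" "k + 1 < j"
    | "i < k" "k + 1 = j" | "j \<le> k" using assms(2) by linarith
  then show "merge_at mul i (merge_at mul j xs) ! k = merge_at mul (j - 1) (merge_at mul i xs) ! k"
    using assms(2,3) k by cases (auto simp: nth_merge_at length_merge_at assoc)
qed

lemma merge_at_rotate_right:
  assumes "1 \<le> i" "i + 1 < length xs"
  shows "merge_at mul i (rotate_right xs) = rotate_right (merge_at mul (i - 1) xs)"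
proof -
  have "xs \<noteq> []" "merge_at mul (i - 1) xs \<noteq> []" using assms by (auto simp: merge_at_def)
  moreover obtain n where "length xs = Suc (Suc n)"
    using assms that[of "length xs - 2"] by linarith
  ultimately show ?thesis
    using assms
    by (intro nth_equalityI)
      (auto simp: nth_merge_at nth_rotate_right length_merge_at length_rotate_right)
qed

text \<open>The wrap-around case of the previous law: two rotations bring the last two entries to the
  front, where face 0 multiplies them.\<close>

lemma merge_at_rotate_right_twice:
  assumes "2 \<le> length xs"
  shows "merge_at mul 0 (rotate_right (rotate_right xs))
    = rotate_right (merge_at mul (length xs - 2) xs)"
proof -
  have "xs \<noteq> []" "rotate_right xs \<noteq> []" "merge_at mul (length xs - 2) xs \<noteq> []"
    using assms by (auto simp: merge_at_def rotate_right_def)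
  moreover obtain n where "length xs = Suc (Suc n)"
    using assms that[of "length xs - 2"] by linarith
  ultimately show ?thesis
    using assms
    by (intro nth_equalityI)
      (auto simp: nth_merge_at nth_rotate_right length_merge_at length_rotate_right numeral_2_eq_2)
qed

lemma cyclic_face_rotate_right:
  assumes "2 \<le> length xs" "1 \<le> i" "i < length xs"
  shows "cyclic_face mul i (rotate_right xs) = rotate_right (cyclic_face mul (i - 1) xs)"
proof (cases "i + 1 < length xs")
  case True
  moreover have "xs \<noteq> []" using assms by auto
  ultimately show ?thesis
    using assms by (simp add: cyclic_face_def length_rotate_right merge_at_rotate_right)
next
  case False
  then have "i = length xs - 1" using assms by linarith
  moreover obtain n where "length xs = Suc (Suc n)"
    using assms that[of "length xs - 2"] by linarith
  moreover have "xs \<noteq> []" using assms by auto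
  ultimately show ?thesis
    using assms merge_at_rotate_right_twice[OF assms(1), of mul]
    by (simp add: cyclic_face_def length_rotate_right numeral_2_eq_2)
qed

lemma cyclic_face_0_rotate_right:
  assumes "2 \<le> length xs"
  shows "cyclic_face mul 0 (rotate_right xs) = cyclic_face mul (length xs - 1) xs"
  using assms by (subgoal_tac "xs \<noteq> []") (auto simp: cyclic_face_def length_rotate_right)

text \<open>The simplicial identity.  Away from the last face it is associativity when the two merges
  overlap, and independence of disjoint merges otherwise.  For the last face, both sides are
  pushed through \<open>rotate_right\<close> until they only involve ordinary merges.\<close>

lemma cyclic_face_cyclic_face:
  assumes assoc: "\<And>x y z. mul (mul x y) z = mul x (mul y z)"
    and xs: "3 \<le> length xs" and ij: "i < j" "j < length xs"
  shows "cyclic_face mul i (cyclic_face mul j xs) = cyclic_face mul (j - 1) (cyclic_face mul i xs)"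
proof (cases "j + 1 < length xs")
  case True
  then show ?thesis
    using ij less_diff_conv[of j "length xs" 1] merge_at_merge_at[where mul=mul, OF assoc ij(1) True]
    by (simp add: cyclic_face_def length_merge_at)
next
  case False
  then have j: "j = length xs - 1" using ij by linarith
  have ne: "xs \<noteq> []" using xs by auto
  let ?d = "cyclic_face mul" and ?r = rotate_right
  have r: "length (?r xs) = length xs" "length (?r (?r xs)) = length xs"
    using ne length_rotate_right[of xs] length_rotate_right[of "?r xs"] by (auto simp: rotate_right_def)
  have merge: "?d 0 (?d k ys) = ?d (k - 1) (?d 0 ys)"
    if "1 \<le> k" "k + 1 < length ys" for k ys
    using that less_diff_conv[of k "length ys" 1] merge_at_merge_at[where mul=mul, OF assoc, of 0 k ys]
    by (simp add: cyclic_face_def length_merge_at)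
  have lhs: "?d i (?d j xs) = ?d i (?d 0 (?r xs))"
    using cyclic_face_0_rotate_right[of xs mul] xs j by simp
  have "?d (j - 1) (?d i xs) = ?d 0 (?r (?d i xs))"
    using cyclic_face_0_rotate_right[of "?d i xs" mul] xs j by (simp add: length_cyclic_face)
  also have "\<dots> = ?d 0 (?d (i + 1) (?r xs))"
    using cyclic_face_rotate_right[of xs "i + 1" mul] xs ij by simp
  finally have rhs: "?d (j - 1) (?d i xs) = ?d 0 (?d (i + 1) (?r xs))" .
  show ?thesis
  proof (cases "i + 1 < j")
    case True
    then show ?thesis unfolding lhs rhs using merge[of "i + 1" "?r xs"] r j by simp
  next
    case False
    then have i: "i + 1 = length xs - 1" using ij j by linarith
    then have len: "length (?d 0 (?r xs)) = i + 1" using xs r by (simp add: length_cyclic_face)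
    \<comment> \<open>Here \<open>i\<close> is the last face of the shorter word, so both faces on the left wrap around and
      the product of three entries \<open>x\<^sub>n\<^sub>-\<^sub>1 x\<^sub>n x\<^sub>0\<close> has to be reassociated.\<close>
    have "?d i (?d 0 (?r xs)) = ?d 0 (?r (?d 0 (?r xs)))"
      using cyclic_face_0_rotate_right[of "?d 0 (?r xs)" mul] len xs i by simp
    also have "\<dots> = ?d 0 (?d 1 (?r (?r xs)))"
      using cyclic_face_rotate_right[of "?r xs" 1 mul] xs r by simp
    also have "\<dots> = ?d 0 (?d 0 (?r (?r xs)))"
      using merge[of 1 "?r (?r xs)"] xs r by simp
    also have "\<dots> = ?d 0 (?d (i + 1) (?r xs))"
      using cyclic_face_0_rotate_right[of "?r xs" mul] xs i r by simp
    finally show ?thesis unfolding lhs rhs .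
  qed
qed

lemma cyclic_diff_eq_sum_faces:
  assumes "length xs = p + 2"
  shows "cyclic_diff mul p F xs = (\<Sum>i\<le>p + 1. (-1) ^ i * F (cyclic_face mul i xs))"
proof -
  obtain x y zs where xs: "xs = x # y # zs"
    using assms by (auto simp: length_Suc_conv eval_nat_numeral)
  have "mul (last xs) (hd xs) # butlast (tl xs) = cyclic_face mul (p + 1) xs"
    using assms unfolding xs by (simp add: cyclic_face_def merge_at_def rotate_right_def)
  moreover have "(\<Sum>i=0..p. (-1) ^ i * F (merge_at mul i xs))
      = (\<Sum>i\<le>p. (-1) ^ i * F (cyclic_face mul i xs))"
    using assms by (intro sum.cong) (auto simp: cyclic_face_def)
  ultimately show ?thesis
    using assms by (simp add: cyclic_diff_def)
qed

lemma cyclic_diff_cyclic_diff: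
  fixes F :: "'a list \<Rightarrow> 'k::field"
  assumes assoc: "\<And>x y z. mul (mul x y) z = mul x (mul y z)"
  shows "cyclic_diff mul (p + 1) (cyclic_diff mul p F) = 0"
proof
  fix xs :: "'a list"
  show "cyclic_diff mul (p + 1) (cyclic_diff mul p F) xs = 0 xs"
  proof (cases "length xs = p + 3")
    case False
    then show ?thesis by (simp add: cyclic_diff_def)
  next
    case True
    let ?g = "\<lambda>(j, i). (-1) ^ (i + j) * F (cyclic_face mul i (cyclic_face mul j xs))"
    let ?I = "{..p + 2} \<times> {..p + 1}"
    let ?U = "{(j, i). i < j \<and> j \<le> p + 2}" and ?L = "{(j, i). j \<le> i \<and> i \<le> p + 1}"
    have I: "?I = ?U \<union> ?L" "?U \<inter> ?L = {}" by auto
    have "finite (?U \<union> ?L)"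
      unfolding I(1)[symmetric] by (intro finite_SigmaI finite_atMost)
    then have fin: "finite ?U" "finite ?L" by simp_all
    have "cyclic_diff mul (p + 1) (cyclic_diff mul p F) xs
        = (\<Sum>j\<le>p + 2. (-1) ^ j * (\<Sum>i\<le>p + 1. (-1) ^ i * F (cyclic_face mul i (cyclic_face mul j xs))))"
      using True
      by (simp add: cyclic_diff_eq_sum_faces length_cyclic_face del: sum.atMost_Suc)
    also have "\<dots> = sum ?g ?I"
      by (simp add: sum.cartesian_product[symmetric] sum_distrib_left power_add mult_ac
          del: sum.atMost_Suc)
    also have "\<dots> = sum ?g ?U + sum ?g ?L"
      unfolding I(1) by (rule sum.union_disjoint[OF fin I(2)])
    also have "sum ?g ?U = sum (\<lambda>x. - ?g x) ?L"
      \<comment> \<open>The simplicial identity matches the two halves term by term, with opposite signs.\<close>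
    proof (rule sum.reindex_bij_witness[of _ "\<lambda>(j, i). (i + 1, j)" "\<lambda>(j, i). (i, j - 1)"])
      fix a assume a: "a \<in> ?U"
      then obtain j i where ji: "a = (j, i)" "i < j" "j \<le> p + 2" by auto
      obtain k where k: "j = Suc k" using ji(2) by (cases j) auto
      show "- ?g (case a of (j, i) \<Rightarrow> (i, j - 1)) = ?g a"
        using cyclic_face_cyclic_face[where mul=mul, OF assoc, of xs i j] ji True k by (simp add: add.commute)
    qed auto
    finally show ?thesis by (simp add: sum_negf)
  qed
qed

text \<open>Rotating the argument shifts face \<open>i + 1\<close> to face \<open>i\<close>, which changes its sign in the alternating
  sum, and moves face 0 to the last place; together with the eigenvalue \<open>(-1)^p\<close> of \<open>F\<close> every term
  acquires the same sign \<open>(-1)^(p + 1)\<close>.  Hence the differential preserves cyclic cochains.\<close>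

lemma cyclic_diff_rotate_right:
  fixes F :: "'a list \<Rightarrow> 'k::field"
  assumes F: "\<And>xs. length xs = p + 1 \<Longrightarrow> F (rotate_right xs) = (-1) ^ p * F xs"
    and xs: "length xs = p + 2"
  shows "cyclic_diff mul p F (rotate_right xs) = (-1) ^ (p + 1) * cyclic_diff mul p F xs"
proof -
  let ?d = "cyclic_face mul"
  have ne: "xs \<noteq> []" using xs by auto
  have "cyclic_diff mul p F (rotate_right xs)
      = (\<Sum>i\<le>Suc p. (-1) ^ i * F (?d i (rotate_right xs)))"
    using xs ne by (subst cyclic_diff_eq_sum_faces) (simp_all add: length_rotate_right)
  also have "\<dots> = F (?d 0 (rotate_right xs)) + (\<Sum>i\<le>p. (-1) ^ (i + 1) * F (?d (i + 1) (rotate_right xs)))"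
    by (simp add: sum.atMost_Suc_shift del: sum.atMost_Suc)
  also have "(\<Sum>i\<le>p. (-1) ^ (i + 1) * F (?d (i + 1) (rotate_right xs)))
      = (\<Sum>i\<le>p. (-1) ^ (p + 1) * ((-1) ^ i * F (?d i xs)))"
  proof (rule sum.cong[OF refl])
    fix i assume "i \<in> {..p}"
    then have "F (?d (i + 1) (rotate_right xs)) = (-1) ^ p * F (?d i xs)"
      using xs by (simp add: cyclic_face_rotate_right F length_cyclic_face)
    then show "(-1) ^ (i + 1) * F (?d (i + 1) (rotate_right xs)) = (-1) ^ (p + 1) * ((-1) ^ i * F (?d i xs))"
      by simp
  qed
  also have "?d 0 (rotate_right xs) = ?d (p + 1) xs"
    using xs by (simp add: cyclic_face_0_rotate_right)
  also have "F (?d (p + 1) xs) + (\<Sum>i\<le>p. (-1) ^ (p + 1) * ((-1) ^ i * F (?d i xs)))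
      = (-1) ^ (p + 1) * (\<Sum>i\<le>p + 1. (-1) ^ i * F (?d i xs))"
    by (simp add: sum_distrib_left algebra_simps flip: power_add mult_2)
  finally show ?thesis using xs by (simp add: cyclic_diff_eq_sum_faces)
qed

lemma linear_ident: "vector_space s \<Longrightarrow> Vector_Spaces.linear s s (\<lambda>x. x)"
  by (simp add: Vector_Spaces.linear_iff)

lemma multilinear_maps_compose:
  assumes "F \<in> multilinear_maps s t n" "length ys = n" "k < n" "Vector_Spaces.linear s s g"
  shows "Vector_Spaces.linear s t (\<lambda>x. F (ys[k := g x]))"
proof -
  have "Vector_Spaces.linear s t (\<lambda>x. F (ys[k := x]))"
    using assms by (simp add: multilinear_maps_def)
  from Vector_Spaces.linear_compose[OF assms(4) this] show ?thesis by (simp add: o_def)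
qed

text \<open>For multilinearity of the differential: as a function of one entry of the word, a face varies
  in just one entry, and linearly.  The entry is either copied or multiplied by a fixed element.
  The list \<open>ys\<close> holds the other entries of the face.\<close>

lemma merge_at_list_update:
  assumes s: "vector_space s"
    and ml: "\<And>y. Vector_Spaces.linear s s (\<lambda>x. mul x y)"
    and mr: "\<And>x. Vector_Spaces.linear s s (\<lambda>y. mul x y)"
    and i: "i + 1 < length xs" and k: "k < length xs"
  obtains g ys k' where "Vector_Spaces.linear s s g" "length ys = length xs - 1" "k' < length xs - 1"
    "\<And>x. merge_at mul i (xs[k := x]) = ys[k' := g x]"
proof -
  let ?m = "merge_at mul i xs"
  note [simp] = nth_merge_at length_merge_at nth_list_update
  consider "k < i" | "k = i" | "k = i + 1" | "i + 1 < k" by linarith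
  then show thesis
  proof cases
    case 1
    then have "merge_at mul i (xs[k := x]) = ?m[k := x]" for x
      using i k by (intro nth_equalityI) auto
    with 1 i k linear_ident[OF s] show ?thesis by (intro that[of "\<lambda>x. x" ?m k]) auto
  next
    case 2
    then have "merge_at mul i (xs[k := x]) = ?m[i := mul x (xs ! (i + 1))]" for x
      using i k by (intro nth_equalityI) auto
    with i ml show ?thesis by (intro that[of "\<lambda>x. mul x (xs ! (i + 1))" ?m i]) auto
  next
    case 3
    then have "merge_at mul i (xs[k := x]) = ?m[i := mul (xs ! i) x]" for x
      using i k by (intro nth_equalityI) auto
    with i mr show ?thesis by (intro that[of "\<lambda>x. mul (xs ! i) x" ?m i]) auto
  next
    case 4
    then have "merge_at mul i (xs[k := x]) = ?m[k - 1 := x]" for x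
      using i k by (intro nth_equalityI) auto
    with 4 i k linear_ident[OF s] show ?thesis by (intro that[of "\<lambda>x. x" ?m "k - 1"]) auto
  qed
qed

lemma rotate_right_list_update:
  assumes "k < length xs"
  shows "rotate_right (xs[k := x]) = (rotate_right xs)[(if k + 1 = length xs then 0 else k + 1) := x]"
proof -
  have "xs \<noteq> []" using assms by auto
  then show ?thesis
    using assms
    by (intro nth_equalityI) (auto simp: length_rotate_right nth_rotate_right nth_list_update)
qed

lemma cyclic_face_list_update:
  assumes s: "vector_space s"
    and ml: "\<And>y. Vector_Spaces.linear s s (\<lambda>x. mul x y)"
    and mr: "\<And>x. Vector_Spaces.linear s s (\<lambda>y. mul x y)"
    and xs: "2 \<le> length xs" and k: "k < length xs"
  obtains g ys k' where "Vector_Spaces.linear s s g" "length ys = length xs - 1" "k' < length xs - 1"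
    "\<And>x. cyclic_face mul i (xs[k := x]) = ys[k' := g x]"
proof (cases "i + 1 < length xs")
  case True
  then show ?thesis
    using merge_at_list_update[OF s ml mr True k] that by (auto simp: cyclic_face_def)
next
  case False
  have ne: "xs \<noteq> []" using xs by auto
  let ?k = "if k + 1 = length xs then 0 else k + 1"
  have "0 + 1 < length (rotate_right xs)" "?k < length (rotate_right xs)"
    using xs k ne by (auto simp: length_rotate_right)
  then obtain g ys k' where "Vector_Spaces.linear s s g" "length ys = length (rotate_right xs) - 1"
    "k' < length (rotate_right xs) - 1"
    "\<And>x. merge_at mul 0 ((rotate_right xs)[?k := x]) = ys[k' := g x]"
    by (rule merge_at_list_update[OF s ml mr]) (rule that)
  then show ?thesis
    using False k rotate_right_list_update[OF k] ne
    by (intro that[of g ys k']) (auto simp: cyclic_face_def length_rotate_right)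
qed

lemma cyclic_diff_mem_multilinear_maps:
  fixes s :: "'k::field \<Rightarrow> 'a::ab_group_add \<Rightarrow> 'a"
  assumes s: "vector_space s"
    and ml: "\<And>y. Vector_Spaces.linear s s (\<lambda>x. mul x y)"
    and mr: "\<And>x. Vector_Spaces.linear s s (\<lambda>y. mul x y)"
    and F: "F \<in> multilinear_maps s times (p + 1)"
  shows "cyclic_diff mul p F \<in> multilinear_maps s times (p + 2)"
proof -
  have "Vector_Spaces.linear s times (\<lambda>x. cyclic_diff mul p F (xs[k := x]))"
    if xs: "length xs = p + 2" and k: "k < p + 2" for xs k
  proof -
    have lin: "Vector_Spaces.linear s times (\<lambda>x. F (cyclic_face mul i (xs[k := x])))" for i
    proof -
      obtain g ys k' where "Vector_Spaces.linear s s g" "length ys = length xs - 1" "k' < length xs - 1"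
        and eq: "\<And>x. cyclic_face mul i (xs[k := x]) = ys[k' := g x]"
        using cyclic_face_list_update[OF s ml mr, of xs k i] xs k by auto
      then show ?thesis
        unfolding eq using xs by (intro multilinear_maps_compose[OF F]) auto
    qed
    then have "F (cyclic_face mul i (xs[k := x + y]))
          = F (cyclic_face mul i (xs[k := x])) + F (cyclic_face mul i (xs[k := y]))"
        "F (cyclic_face mul i (xs[k := s c x])) = c * F (cyclic_face mul i (xs[k := x]))" for i x y c
      by (simp_all add: Vector_Spaces.linear_iff)
    then show ?thesis
      using xs s
      by (simp add: Vector_Spaces.linear_iff cyclic_diff_eq_sum_faces vector_space_times
          distrib_left sum.distrib sum_distrib_left mult.left_commute del: sum.atMost_Suc)
  qed
  then show ?thesis by (auto simp: multilinear_maps_def cyclic_diff_def)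
qed

lemma subspace_multilinear_maps:
  fixes s :: "'k::field \<Rightarrow> 'a::ab_group_add \<Rightarrow> 'a" and t :: "'k \<Rightarrow> 'w::ab_group_add \<Rightarrow> 'w"
  assumes s: "vector_space s" and t: "vector_space t"
  shows "module.subspace (fscale t) (multilinear_maps s t n)"
proof -
  interpret t: vector_space t by fact
  interpret ft: vector_space "fscale t :: 'k \<Rightarrow> ('a list \<Rightarrow> 'w) \<Rightarrow> 'a list \<Rightarrow> 'w"
    by (rule vector_space_fscale) fact
  show ?thesis
    using s t
    by (auto simp: ft.subspace_def multilinear_maps_def fscale_def Vector_Spaces.linear_iff
        t.scale_right_distrib mult.commute)
qed

text \<open>The sign \<open>(-1)^p\<close> is its own inverse, so invariance under the cyclic operator says that \<open>F\<close> is an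
  eigenvector for rotation.\<close>

lemma cyclic_cochains_iff:
  "F \<in> cyclic_cochains s p \<longleftrightarrow> F \<in> multilinear_maps s times (p + 1) \<and>
     (\<forall>xs. length xs = p + 1 \<longrightarrow> F (rotate_right xs) = (-1) ^ p * F xs)"
proof -
  have "(F xs - (-1) ^ p * F (last xs # butlast xs) = 0) = (F (last xs # butlast xs) = (-1) ^ p * F xs)" for xs
    by (cases "even p") (auto simp: add_eq_0_iff add_eq_0_iff2)
  then show ?thesis
    by (auto simp: cyclic_cochains_def cyclic_op_def rotate_right_def fun_eq_iff multilinear_maps_def)
qed

lemma subspace_cyclic_cochains:
  fixes s :: "'k::field \<Rightarrow> 'a::ab_group_add \<Rightarrow> 'a"
  assumes s: "vector_space s"
  shows "module.subspace (fscale times) (cyclic_cochains s p)"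
proof -
  interpret ft: vector_space "fscale times :: 'k \<Rightarrow> ('a list \<Rightarrow> 'k) \<Rightarrow> 'a list \<Rightarrow> 'k"
    by (rule vector_space_fscale[OF vector_space_times])
  show ?thesis
    using subspace_multilinear_maps[OF s vector_space_times, of "p + 1"]
    by (auto simp: ft.subspace_def cyclic_cochains_iff fscale_def algebra_simps)
qed

lemma cochain_complex_cyclic:
  fixes s :: "'k::field \<Rightarrow> 'a::ab_group_add \<Rightarrow> 'a"
  assumes s: "vector_space s"
    and assoc: "\<And>x y z. mul (mul x y) z = mul x (mul y z)"
    and ml: "\<And>y. Vector_Spaces.linear s s (\<lambda>x. mul x y)"
    and mr: "\<And>x. Vector_Spaces.linear s s (\<lambda>y. mul x y)"
  shows "cochain_complex (fscale times) (cyclic_cochains s) (cyclic_diff mul)"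
proof -
  have "cyclic_diff mul p F \<in> cyclic_cochains s (p + 1)" if "F \<in> cyclic_cochains s p" for p F
    using that cyclic_diff_mem_multilinear_maps[OF s ml mr, of F p] cyclic_diff_rotate_right[of p F _ mul]
    by (simp add: cyclic_cochains_iff)
  then have "linear_map_on (fscale times) (fscale times) (cyclic_cochains s p)
      (cyclic_cochains s (p + 1)) (cyclic_diff mul p)" for p
    by (auto simp: linear_map_on_def cyclic_diff_def fscale_def fun_eq_iff algebra_simps
        sum.distrib sum_distrib_left)
  then show ?thesis
    using subspace_cyclic_cochains[OF s] cyclic_diff_cyclic_diff[where mul=mul, OF assoc]
    by (auto simp: cochain_complex_def)
qed


section \<open>The Frobenius form and the comparison map\<close>

context symmetric_frobenius_algebra
begin

lemma form_add_left: "form (x + y) z = form x z + form y z"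
  and form_scale_left: "form (scale c x) z = c * form x z"
  using form_linear_left[of z] by (simp_all add: Vector_Spaces.linear_iff)

lemma form_add_right: "form z (x + y) = form z x + form z y"
  and form_scale_right: "form z (scale c x) = c * form z x"
  using form_linear_right[of z] by (simp_all add: Vector_Spaces.linear_iff)

lemma form_zero_left: "form 0 z = 0"
  using form_scale_left[of 0 0 z] by simp

lemma form_diff_left: "form (x - y) z = form x z - form y z"
  using form_add_left[of "x - y" y z] by simp

lemma form_sum_left: "form (sum f I) z = (\<Sum>i\<in>I. form (f i) z)"
  by (induction I rule: infinite_finite_induct) (simp_all add: form_zero_left form_add_left)

lemma form_inject: "(\<And>z. form x z = form y z) \<Longrightarrow> x = y"
  using form_nondegenerate[of "x - y"] by (simp add: form_diff_left)

text \<open>Finite dimension enters here.  With a basis \<open>B\<close>, the map \<open>a \<mapsto> (\<langle>a, b\<rangle>)\<^sub>b\<close> into coordinate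
  space, which is identified with \<open>A\<close> itself by \<open>B\<close>, is injective by non-degeneracy and therefore
  surjective.\<close>

lemma form_represents:
  assumes fd: "finite_dimensional_vector_space scale B"
    and \<phi>: "Vector_Spaces.linear scale times \<phi>"
  shows "\<exists>a. \<forall>y. form a y = \<phi> y"
proof -
  interpret fd: finite_dimensional_vector_space scale B by fact
  have agree: "form a y = \<psi> y"
    if "Vector_Spaces.linear scale times \<psi>" and eq: "\<And>b. b \<in> B \<Longrightarrow> form a b = \<psi> b" for a \<psi> y
  proof -
    have "y \<in> span B" by (simp add: fd.span_Basis)
    then show ?thesis
    proof (induction rule: span_induct_alt)
      case base
      show ?case using that(1) by (metis form_scale_right Vector_Spaces.linear_iff mult_zero_left scale_zero_left)
    next
      case (step c x z)
      then show ?case using that by (simp add: form_add_right form_scale_right Vector_Spaces.linear_iff)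
    qed
  qed
  have coeff: "u b = v b" if "(\<Sum>b\<in>B. scale (u b) b) = (\<Sum>b\<in>B. scale (v b) b)" "b \<in> B" for u v b
  proof -
    have "(\<Sum>b\<in>B. scale (u b - v b) b) = 0"
      using that(1) by (simp add: scale_left_diff_distrib sum_subtractf)
    from independentD[OF fd.independent_Basis fd.finite_Basis subset_refl this that(2)]
    show ?thesis by simp
  qed
  let ?T = "\<lambda>a. \<Sum>b\<in>B. scale (form a b) b"
  have "Vector_Spaces.linear scale scale ?T"
    by (simp add: Vector_Spaces.linear_iff vector_space_axioms form_add_left form_scale_left
        scale_left_distrib sum.distrib scale_sum_right)
  moreover have "inj ?T"
  proof (rule injI)
    fix x y assume "?T x = ?T y"
    from coeff[OF this] have "form x b = form y b" if "b \<in> B" for b using that by blast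
    then have "form x z = form y z" for z
      using agree[of "form y" x z] form_linear_right[of y] by blast
    then show "x = y" by (rule form_inject)
  qed
  ultimately have "surj ?T" by (rule fd.linear_inj_imp_surj)
  then obtain a where a: "(\<Sum>b\<in>B. scale (\<phi> b) b) = ?T a" by (rule surjE)
  have "form a b = \<phi> b" if "b \<in> B" for b using coeff[OF a that] by simp
  then have "form a y = \<phi> y" for y by (rule agree[OF \<phi>])
  then show ?thesis by blast
qed

lemma J_map_Cons: "length xs = p \<Longrightarrow> J_map form p F (x # xs) = form (F xs) x"
  by (simp add: J_map_def)

text \<open>Stated for all functions supported on lists of length \<open>p\<close>, in order to identify a function whose
  multilinearity is still to be shown with a multilinear one.\<close>

lemma J_map_inject:
  assumes eq: "J_map form p F = J_map form p G"
    and F: "\<And>xs. length xs \<noteq> p \<Longrightarrow> F xs = 0" and G: "\<And>xs. length xs \<noteq> p \<Longrightarrow> G xs = 0"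
  shows "F = G"
proof
  fix xs
  show "F xs = G xs"
  proof (cases "length xs = p")
    case True
    then have "form (F xs) z = form (G xs) z" for z
      using fun_cong[OF eq, of "z # xs"] by (simp add: J_map_Cons)
    then show ?thesis by (rule form_inject)
  qed (simp add: F G)
qed

lemma J_map_mem_multilinear_maps:
  assumes F: "F \<in> multilinear_maps scale scale p"
  shows "J_map form p F \<in> multilinear_maps scale times (p + 1)"
proof -
  have "Vector_Spaces.linear scale times (\<lambda>x. J_map form p F (xs[k := x]))"
    if "length xs = p + 1" "k < p + 1" for xs k
  proof -
    obtain y ys where xs: "xs = y # ys" "length ys = p"
      using \<open>length xs = p + 1\<close> by (auto simp: length_Suc_conv)
    show ?thesis
    proof (cases k)
      case 0
      then show ?thesis using xs form_linear_right by (simp add: J_map_Cons)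
    next
      case (Suc j)
      then have "Vector_Spaces.linear scale scale (\<lambda>x. F (ys[j := x]))"
        using F xs that(2) by (simp add: multilinear_maps_def)
      then show ?thesis
        using xs Suc vector_space_axioms
        by (simp add: J_map_Cons Vector_Spaces.linear_iff vector_space_times form_add_left form_scale_left)
    qed
  qed
  then show ?thesis by (auto simp: multilinear_maps_def J_map_def)
qed

text \<open>Fixing all arguments but \<open>x\<^sub>0\<close> leaves a functional, which the form represents by a unique element;
  uniqueness makes that element depend linearly on each remaining argument.\<close>

lemma J_map_surj:
  assumes fd: "finite_dimensional_vector_space scale B"
    and G: "G \<in> multilinear_maps scale times (p + 1)"
  obtains F where "F \<in> multilinear_maps scale scale p" "J_map form p F = G"
proof -
  have Glin: "Vector_Spaces.linear scale times (\<lambda>x. G (xs[k := x]))"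
    if "length xs = p + 1" "k < p + 1" for xs k
    using G that by (auto simp: multilinear_maps_def)
  have "\<exists>a. \<forall>y. form a y = G (y # xs)" if "length xs = p" for xs
    using form_represents[OF fd Glin[of "0 # xs" 0]] that by simp
  then obtain F' where F': "\<And>xs y. length xs = p \<Longrightarrow> form (F' xs) y = G (y # xs)"
    by metis
  define F where "F xs = (if length xs = p then F' xs else 0)" for xs
  have F: "form (F xs) y = G (y # xs)" if "length xs = p" for xs y
    using that by (simp add: F_def F')
  have "Vector_Spaces.linear scale scale (\<lambda>x. F (xs[k := x]))" if "length xs = p" "k < p" for xs k
  proof -
    have lin: "Vector_Spaces.linear scale times (\<lambda>x. G (z # xs[k := x]))" for z
      using Glin[of "z # xs" "Suc k"] that by simp
    have "F (xs[k := x + y]) = F (xs[k := x]) + F (xs[k := y])" for x y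
      by (rule form_inject) (use that lin in \<open>simp add: F form_add_left Vector_Spaces.linear_iff\<close>)
    moreover have "F (xs[k := scale c x]) = scale c (F (xs[k := x]))" for c x
      by (rule form_inject) (use that lin in \<open>simp add: F form_scale_left Vector_Spaces.linear_iff\<close>)
    ultimately show ?thesis
      by (simp add: Vector_Spaces.linear_iff vector_space_axioms)
  qed
  then have "F \<in> multilinear_maps scale scale p" by (auto simp: multilinear_maps_def F_def)
  moreover have "J_map form p F = G"
  proof
    fix xs show "J_map form p F xs = G xs"
      using G F by (cases xs) (auto simp: J_map_def multilinear_maps_def)
  qed
  ultimately show thesis by (rule that)
qed

lemma J_map_add: "J_map form p (F + G) = J_map form p F + J_map form p G"
  by (auto simp: J_map_def form_add_left)

lemma J_map_fscale: "J_map form p (fscale scale c F) = fscale times c (J_map form p F)"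
  by (auto simp: J_map_def fscale_def form_scale_left)

lemma linear_iso_on_J_map:
  assumes fd: "finite_dimensional_vector_space scale B"
  shows "linear_iso_on (fscale scale) (fscale times)
    (multilinear_maps scale scale p) (multilinear_maps scale times (p + 1)) (J_map form p)"
proof -
  have "inj_on (J_map form p) (multilinear_maps scale scale p)"
    by (rule inj_onI, rule J_map_inject) (auto simp: multilinear_maps_def)
  moreover have "J_map form p ` multilinear_maps scale scale p = multilinear_maps scale times (p + 1)"
    using J_map_mem_multilinear_maps by (blast elim: J_map_surj[OF fd])
  ultimately show ?thesis
    using subspace_multilinear_maps[OF vector_space_axioms vector_space_axioms]
      subspace_multilinear_maps[OF vector_space_axioms vector_space_times]
    by (auto simp: linear_iso_on_def linear_map_on_def bij_betw_def J_map_add J_map_fscale)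
qed

lemma rb_cochains_iff:
  assumes "F \<in> multilinear_maps scale scale p"
  shows "F \<in> rb_cochains scale form p \<longleftrightarrow> J_map form p F \<in> cyclic_cochains scale p"
proof -
  have "(form (F (tl xs)) (hd xs) = (-1) ^ p * form (F (butlast xs)) (last xs))
      = (J_map form p F (rotate_right xs) = (-1) ^ p * J_map form p F xs)"
    if "length xs = p + 1" for xs
  proof -
    have "(a = (-1) ^ p * b) = (b = (-1) ^ p * a)" for a b :: 'k
      by (cases "even p") auto
    then show ?thesis using that by (auto simp: J_map_def rotate_right_def)
  qed
  then show ?thesis
    using assms J_map_mem_multilinear_maps[OF assms] by (auto simp: rb_cochains_def cyclic_cochains_iff)
qed

lemma linear_iso_on_J_map_cyclic:
  assumes fd: "finite_dimensional_vector_space scale B"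
  shows "linear_iso_on (fscale scale) (fscale times)
    (rb_cochains scale form p) (cyclic_cochains scale p) (J_map form p)"
proof -
  interpret fv: vector_space "fscale scale :: 'k \<Rightarrow> ('a list \<Rightarrow> 'a) \<Rightarrow> 'a list \<Rightarrow> 'a"
    by (rule vector_space_fscale[OF vector_space_axioms])
  interpret fk: vector_space "fscale times :: 'k \<Rightarrow> ('a list \<Rightarrow> 'k) \<Rightarrow> 'a list \<Rightarrow> 'k"
    by (rule vector_space_fscale[OF vector_space_times])
  let ?M = "multilinear_maps scale scale p" and ?J = "J_map form p"
  let ?rb = "rb_cochains scale form p" and ?cyc = "cyclic_cochains scale p"
  note iso = linear_iso_on_J_map[OF fd, of p]
  have M: "fv.subspace ?M" and C: "fk.subspace ?cyc"
    using subspace_multilinear_maps[OF vector_space_axioms vector_space_axioms]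
      subspace_cyclic_cochains[OF vector_space_axioms] by auto
  have rb: "?rb = {F \<in> ?M. ?J F \<in> ?cyc}"
    using rb_cochains_iff by (auto simp: rb_cochains_def)
  have "?J 0 = 0" by (auto simp: J_map_def form_zero_left)
  then have "fv.subspace ?rb"
    using M C unfolding rb fv.subspace_def fk.subspace_def by (auto simp: J_map_add J_map_fscale)
  moreover have "?J ` ?rb = ?cyc"
    using iso unfolding rb by (auto simp: linear_iso_on_def bij_betw_def cyclic_cochains_def image_iff)
  moreover have "inj_on ?J ?rb"
    using iso by (auto simp: linear_iso_on_def bij_betw_def rb inj_on_def)
  ultimately show ?thesis
    using C by (auto simp: linear_iso_on_def linear_map_on_def bij_betw_def J_map_add J_map_fscale)
qed


section \<open>Comparison of the differentials\<close>

text \<open>The actions \<open>rb_left_action\<close> and \<open>rb_right_action\<close> are the adjoints of descendent multiplication with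
  respect to the form (the facts \<open>left\<close> and \<open>right\<close> in the proof): the summand \<open>R (a * b)\<close> yields the
  half of the descendent product in which \<open>R\<close> acts on the other factor.\<close>

lemma J_map_rb_hochschild_diff:
  assumes skew: "skew_symmetric_operator form R"
  shows "J_map form (p + 1) (rb_hochschild_diff scale R p F)
    = cyclic_diff (descendent_mult R) p (J_map form p F)"
proof
  fix xs :: "'a list"
  let ?m = "descendent_mult R"
  have skew: "form (R x) y = - form x (R y)" for x y
    using skew by (simp add: skew_symmetric_operator_def)
  have cyc: "form (x * y) z = form y (z * x)" for x y z
    by (metis form_invariant form_sym)
  have left: "form (rb_left_action R a b) c = form b (?m c a)" for a b c
    using cyc[of "R a" b c] cyc[of a b "R c"]
    by (simp add: rb_left_action_def descendent_mult_def form_diff_left form_add_right skew add.commute)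
  have right: "form (rb_right_action R a b) c = form b (?m a c)" for a b c
    by (simp add: rb_right_action_def descendent_mult_def form_diff_left form_add_right skew form_invariant)
  show "J_map form (p + 1) (rb_hochschild_diff scale R p F) xs = cyclic_diff ?m p (J_map form p F) xs"
  proof (cases "length xs = p + 2")
    case False
    then show ?thesis by (simp add: J_map_def cyclic_diff_def)
  next
    case True
    then obtain x ys where xs: "xs = x # ys" "length ys = p + 1"
      by (cases xs) auto
    then have ys: "ys \<noteq> []" by auto
    have "(\<Sum>i=0..p. (-1) ^ i * J_map form p F (merge_at ?m i xs))
        = form (F (tl ys)) (?m x (hd ys)) + (\<Sum>i=1..p. (-1) ^ i * J_map form p F (merge_at ?m i xs))"
      using xs ys
      by (simp add: sum.atLeast_Suc_atMost J_map_def merge_at_def hd_conv_nth drop_Suc)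
    also have "(\<Sum>i=1..p. (-1) ^ i * J_map form p F (merge_at ?m i xs))
        = (\<Sum>i=1..p. (-1) ^ i * form (F (merge_at ?m (i - 1) ys)) x)"
    proof (rule sum.cong[OF refl])
      fix i assume "i \<in> {1..p}"
      then obtain j where "i = Suc j" "j < p" by (cases i) auto
      then show "(-1) ^ i * J_map form p F (merge_at ?m i xs)
          = (-1) ^ i * form (F (merge_at ?m (i - 1) ys)) x"
        using xs by (simp add: J_map_def merge_at_def)
    qed
    finally show ?thesis
      using xs ys
      by (simp add: J_map_def rb_hochschild_diff_def hochschild_diff_def cyclic_diff_def
          form_add_left form_diff_left form_sum_left form_scale_left left right)
  qed
qed

text \<open>In \<open>[R, F]\<close>, the part with \<open>R\<close> outermost supplies \<open>(-1)^p\<close> times the left action, together with the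
  summand \<open>R(F(\<dots>) x\<^sub>p\<^sub>+\<^sub>1)\<close> of the right action.  The part with \<open>F\<close> outermost has \<open>R\<close> acting on either of two
  neighbours; additivity of \<open>F\<close> in that slot merges these pairs into descendent products, and its
  last term completes the right action.\<close>

lemma rb_diff_eq_rb_hochschild_diff:
  assumes R: "Vector_Spaces.linear scale scale R"
    and F: "F \<in> multilinear_maps scale scale p"
  shows "rb_diff scale R p F = fscale scale ((-1) ^ p) (rb_hochschild_diff scale R p F)"
proof
  fix xs :: "'a list"
  have R_diff: "R (x - y) = R x - R y" for x y
  proof -
    have "R (x - y + y) = R (x - y) + R y" using R unfolding Vector_Spaces.linear_iff by blast
    then show ?thesis by simp
  qed
  show "rb_diff scale R p F xs = fscale scale ((-1) ^ p) (rb_hochschild_diff scale R p F) xs"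
  proof (cases "length xs = p + 1")
    case False
    then show ?thesis
      by (simp add: rb_diff_def rb_bracket_elem_def rb_bracket_def rb_circ_def fscale_def
          rb_hochschild_diff_def hochschild_diff_def)
  next
    case len: True
    show ?thesis
    proof (cases "p = 0")
      case True
      with len obtain x where "xs = [x]" by (auto simp: length_Suc_conv)
      with True show ?thesis
        by (simp add: rb_diff_def rb_bracket_elem_def unary_cochain_def fscale_def R_diff
            rb_hochschild_diff_def hochschild_diff_def rb_left_action_def rb_right_action_def)
    next
      case False
      let ?S = "\<lambda>i. F (take (i - 1) xs @ [R (xs ! (i - 1)) * xs ! i] @ drop (i + 1) xs)"
      let ?T = "\<lambda>i. F (take (i - 1) xs @ [xs ! (i - 1) * R (xs ! i)] @ drop (i + 1) xs)"
      have merge: "F (merge_at (descendent_mult R) (i - 1) xs) = ?S i + ?T i" if i: "i \<in> {1..p}" for i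
      proof -
        let ?ys = "take (i - 1) xs @ [0] @ drop (i + 1) xs"
        have "Vector_Spaces.linear scale scale (\<lambda>x. F (?ys[i - 1 := x]))"
          using F len i by (auto simp: multilinear_maps_def)
        moreover have "?ys[i - 1 := x] = take (i - 1) xs @ [x] @ drop (i + 1) xs" for x
          using len i by (auto simp: list_update_append)
        moreover have "i - 1 + 1 = i" "i - 1 + 2 = i + 1" using i by auto
        ultimately show ?thesis
          by (simp only: merge_at_def descendent_mult_def Vector_Spaces.linear_iff)
      qed
      have "xs \<noteq> []" using len by auto
      then have split: "take p xs = butlast xs" "xs ! p = last xs"
        using len by (simp_all add: butlast_conv_take last_conv_nth)
      have circ1: "rb_circ scale 1 p (unary_cochain R) F xs
          = R (F (butlast xs) * last xs) - scale ((-1) ^ p) (R (hd xs * F (tl xs)))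
            + scale ((-1) ^ p) (R (hd xs) * F (tl xs))"
      proof -
        obtain x ys where "xs = x # ys" "length ys = p" using len by (cases xs) auto
        then show ?thesis
          using split by (simp add: rb_circ_def unary_cochain_def)
      qed
      have circ2: "rb_circ scale p 1 F (unary_cochain R) xs
          = - (\<Sum>i=1..p. scale ((-1) ^ i) (F (merge_at (descendent_mult R) (i - 1) xs)))
            + scale ((-1) ^ p) (F (butlast xs) * R (last xs))"
      proof -
        have "unary_cochain R (take 1 (drop j xs)) = R (xs ! j)" if "j \<le> p" for j
          using len that by (simp add: unary_cochain_def hd_drop_conv_nth)
        then have R_at: "unary_cochain R (take 1 (drop (i - 1) xs)) = R (xs ! (i - 1))"
            "unary_cochain R (take 1 (drop i xs)) = R (xs ! i)" if "i \<in> {1..p}" for i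
          using that by auto
        \<comment> \<open>The index range starts at 1, so that the subtraction in the exponent is not truncated.\<close>
        have sign: "scale ((-1) ^ ((i - 1) * 1)) v = - scale ((-1) ^ i) v" if "i \<in> {1..p}" for i v
          using that by (cases i) simp_all
        have "(\<Sum>i=1..p. scale ((-1) ^ ((i - 1) * 1)) (F (take (i - 1) xs
              @ [unary_cochain R (take 1 (drop (i - 1) xs)) * xs ! (i + 1 - 1)] @ drop (i + 1) xs)))
            = (\<Sum>i=1..p. - scale ((-1) ^ i) (?S i))"
          by (intro sum.cong refl) (simp only: sign R_at add_diff_cancel_right')
        moreover have "(\<Sum>i=1..p. scale ((-1) ^ (i * 1)) (F (take (i - 1) xs
              @ [xs ! (i - 1) * unary_cochain R (take 1 (drop i xs))] @ drop (i + 1) xs)))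
            = (\<Sum>i=1..p. scale ((-1) ^ i) (?T i))"
          by (intro sum.cong refl) (simp only: R_at mult_1_right)
        moreover have "(\<Sum>i=1..p. scale ((-1) ^ i) (F (merge_at (descendent_mult R) (i - 1) xs)))
            = (\<Sum>i=1..p. scale ((-1) ^ i) (?S i)) + (\<Sum>i=1..p. scale ((-1) ^ i) (?T i))"
          unfolding sum.distrib[symmetric] scale_right_distrib[symmetric]
          by (intro sum.cong refl) (simp only: merge)
        moreover have "unary_cochain R (drop p xs) = R (last xs)"
          using len split by (simp add: unary_cochain_def hd_drop_conv_nth)
        ultimately show ?thesis
          using len split by (simp only: rb_circ_def) (simp add: sum_negf)
      qed
      have sgn: "scale ((-1) ^ p) (scale ((-1) ^ p) v) = v" for v
        by (simp add: flip: power_add mult_2)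
      show ?thesis
        using len False
        by (simp add: rb_diff_def rb_bracket_def circ1[simplified] circ2[simplified] fscale_def rb_hochschild_diff_def
            hochschild_diff_def rb_left_action_def rb_right_action_def scale_right_distrib
            scale_right_diff_distrib sgn)
    qed
  qed
qed

lemma J_map_rb_diff:
  assumes "Vector_Spaces.linear scale scale R" "skew_symmetric_operator form R"
    and "F \<in> multilinear_maps scale scale p"
  shows "J_map form (p + 1) (rb_diff scale R p F)
    = fscale times ((-1) ^ p) (cyclic_diff (descendent_mult R) p (J_map form p F))"
  by (simp only: rb_diff_eq_rb_hochschild_diff[OF assms(1,3)] J_map_fscale
      J_map_rb_hochschild_diff[OF assms(2)])

lemma linear_descendent_mult:
  assumes R: "Vector_Spaces.linear scale scale R"
  shows "Vector_Spaces.linear scale scale (\<lambda>x. descendent_mult R x y)"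
    and "Vector_Spaces.linear scale scale (\<lambda>y. descendent_mult R x y)"
  using R
  by (simp_all add: Vector_Spaces.linear_iff descendent_mult_def algebra_simps
      scale_mult_left scale_mult_right)

lemma cochain_complex_cyclic_descendent:
  assumes R: "rota_baxter_operator scale R"
  shows "cochain_complex (fscale times) (cyclic_cochains scale) (cyclic_diff (descendent_mult R))"
  using R
  by (intro cochain_complex_cyclic vector_space_axioms linear_descendent_mult
      descendent_mult_assoc[OF R]) (simp_all add: rota_baxter_operator_def)

text \<open>The image of the differential under \<open>J_map\<close> is a cyclic cochain, hence also the image of some
  Rota-Baxter cochain; injectivity of \<open>J_map\<close> identifies the two.  This yields multilinearity
  and the symmetry condition at once.\<close>

lemma rb_diff_mem_rb_cochains:
  assumes fd: "finite_dimensional_vector_space scale B"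
    and R: "rota_baxter_operator scale R" and skew: "skew_symmetric_operator form R"
    and F: "F \<in> rb_cochains scale form p"
  shows "rb_diff scale R p F \<in> rb_cochains scale form (p + 1)"
proof -
  interpret fk: vector_space "fscale times :: 'k \<Rightarrow> ('a list \<Rightarrow> 'k) \<Rightarrow> 'a list \<Rightarrow> 'k"
    by (rule vector_space_fscale[OF vector_space_times])
  note iso = linear_iso_on_J_map_cyclic[OF fd]
  have FM: "F \<in> multilinear_maps scale scale p" using F by (simp add: rb_cochains_def)
  have "J_map form p F \<in> cyclic_cochains scale p" using F rb_cochains_iff[OF FM] by simp
  then have "cyclic_diff (descendent_mult R) p (J_map form p F) \<in> cyclic_cochains scale (p + 1)"
    using cochain_complex_cyclic_descendent[OF R] linear_map_onD(1)
    unfolding cochain_complex_def by blast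
  then have "J_map form (p + 1) (rb_diff scale R p F) \<in> cyclic_cochains scale (p + 1)"
    using R J_map_rb_diff[OF _ skew FM] fk.subspace_scale[OF subspace_cyclic_cochains[OF vector_space_axioms]]
    by (simp add: rota_baxter_operator_def)
  then obtain G where G: "G \<in> rb_cochains scale form (p + 1)"
    and eq: "J_map form (p + 1) (rb_diff scale R p F) = J_map form (p + 1) G"
    using iso[of "p + 1"] by (auto simp: linear_iso_on_def bij_betw_def)
  have "rb_diff scale R p F = G"
  proof (rule J_map_inject[OF eq])
    show "rb_diff scale R p F xs = 0" if "length xs \<noteq> p + 1" for xs
      using that by (simp add: rb_diff_def rb_bracket_elem_def rb_bracket_def rb_circ_def)
    show "G xs = 0" if "length xs \<noteq> p + 1" for xs
      using that G by (simp add: rb_cochains_def multilinear_maps_def)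
  qed
  with G show ?thesis by simp
qed

lemma linear_iso_on_J_tilde:
  assumes fd: "finite_dimensional_vector_space scale B"
  shows "linear_iso_on (fscale scale) (fscale times)
    (rb_cochains scale form p) (cyclic_cochains scale p) (J_tilde form p)"
proof (cases "even (p * (p - 1) div 2)")
  case True
  then have "J_tilde form p = J_map form p"
    by (auto simp: J_tilde_def fscale_def)
  then show ?thesis using linear_iso_on_J_map_cyclic[OF fd] by simp
next
  case False
  interpret fv: vector_space "fscale scale :: 'k \<Rightarrow> ('a list \<Rightarrow> 'a) \<Rightarrow> 'a list \<Rightarrow> 'a"
    by (rule vector_space_fscale[OF vector_space_axioms])
  interpret fk: vector_space "fscale times :: 'k \<Rightarrow> ('a list \<Rightarrow> 'k) \<Rightarrow> 'a list \<Rightarrow> 'k"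
    by (rule vector_space_fscale[OF vector_space_times])
  have eq: "J_tilde form p = (\<lambda>F. - J_map form p F)"
    using False by (intro ext) (simp add: J_tilde_def fscale_def)
  have J: "linear_iso_on (fscale scale) (fscale times)
      (rb_cochains scale form p) (cyclic_cochains scale p) (J_map form p)"
    by (rule linear_iso_on_J_map_cyclic[OF fd])
  then have sub: "fk.subspace (cyclic_cochains scale p)" by (simp add: linear_iso_on_def)
  have "bij_betw uminus (cyclic_cochains scale p :: ('a list \<Rightarrow> 'k) set) (cyclic_cochains scale p)"
    by (rule bij_betw_byWitness[where f' = uminus]) (auto intro: fk.subspace_neg[OF sub])
  then have "bij_betw (J_tilde form p) (rb_cochains scale form p) (cyclic_cochains scale p)"
    using J bij_betw_trans[of "J_map form p"] unfolding eq by (fastforce simp: linear_iso_on_def o_def)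
  then show ?thesis
    using J unfolding eq
    by (auto simp: linear_iso_on_def linear_map_on_def fk.subspace_neg[OF sub] image_subset_iff)
qed

lemma cochain_iso_J_tilde:
  assumes fd: "finite_dimensional_vector_space scale B"
    and R: "rota_baxter_operator scale R" and skew: "skew_symmetric_operator form R"
  shows "cochain_iso (fscale scale) (rb_cochains scale form) (rb_diff scale R)
    (fscale times) (cyclic_cochains scale) (cyclic_diff (descendent_mult R)) (J_tilde form)"
proof (rule cochain_iso_transfer)
  fix p F assume F: "F \<in> rb_cochains scale form p"
  show "rb_diff scale R p F \<in> rb_cochains scale form (p + 1)"
    by (rule rb_diff_mem_rb_cochains[OF fd R skew F])
  have lin: "Vector_Spaces.linear scale scale R" using R by (simp add: rota_baxter_operator_def)
  have FM: "F \<in> multilinear_maps scale scale p" using F by (simp add: rb_cochains_def)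
  \<comment> \<open>The sign of \<open>J_tilde\<close> changes by \<open>(-1)^p\<close> from degree \<open>p\<close> to \<open>p + 1\<close>, which cancels the sign in
    \<open>J_map_rb_diff\<close>.\<close>
  have "(p + 1) * (p + 1 - 1) div 2 = p * (p - 1) div 2 + p"
  proof -
    have "(p + 1) * (p + 1 - 1) = p * (p - 1) + p * 2"
      by (cases p) (simp_all add: algebra_simps)
    then show ?thesis by simp
  qed
  then have sign: "(-1) ^ ((p + 1) * (p + 1 - 1) div 2) * (-1) ^ p = ((-1) ^ (p * (p - 1) div 2) :: 'k)"
    by (simp add: power_add flip: power_mult_distrib)
  have "fscale times a (fscale times b f) = fscale times (a * b) f" for a b :: 'k and f :: "'a list \<Rightarrow> 'k"
    by (simp add: fscale_def mult.assoc)
  moreover have "cyclic_diff m p (fscale times a f) = fscale times a (cyclic_diff m p f)"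
    for a :: 'k and f :: "'a list \<Rightarrow> 'k" and m
    by (auto simp: cyclic_diff_def fscale_def algebra_simps sum_distrib_left)
  ultimately show "J_tilde form (p + 1) (rb_diff scale R p F)
      = cyclic_diff (descendent_mult R) p (J_tilde form p F)"
    by (simp only: J_tilde_def J_map_rb_diff[OF lin skew FM] sign)
qed (use vector_space_fscale vector_space_axioms vector_space_times linear_iso_on_J_tilde[OF fd]
    cochain_complex_cyclic_descendent[OF R] in blast)+

end

theorem proposition3p14:
  fixes scale :: "'k::field_char_0 \<Rightarrow> 'a::ring \<Rightarrow> 'a"
    and form :: "'a \<Rightarrow> 'a \<Rightarrow> 'k"
    and R :: "'a \<Rightarrow> 'a"
  assumes "symmetric_frobenius_algebra scale form"
    and "\<exists>Basis. finite_dimensional_vector_space scale Basis"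
    and "rota_baxter_operator scale R"
    and "skew_symmetric_operator form R"
  shows
    "(\<forall>p. linear_iso_on (fscale scale) (fscale times)
        (multilinear_maps scale scale p) (multilinear_maps scale times (p + 1)) (J_map form p))
   \<and> (\<forall>p. \<forall>F\<in>multilinear_maps scale scale p.
        J_map form (p + 1) (rb_hochschild_diff scale R p F)
        = cyclic_diff (descendent_mult R) p (J_map form p F))
   \<and> (\<forall>p. \<forall>F\<in>multilinear_maps scale scale p.
        J_map form (p + 1) (rb_diff scale R p F)
        = fscale times ((-1) ^ p) (cyclic_diff (descendent_mult R) p (J_map form p F)))
   \<and> (\<forall>p. linear_iso_on (fscale scale) (fscale times)
        (rb_cochains scale form p) (cyclic_cochains scale p) (J_map form p))
   \<and> cochain_iso
        (fscale scale) (rb_cochains scale form) (rb_diff scale R)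
        (fscale times) (cyclic_cochains scale) (cyclic_diff (descendent_mult R))
        (J_tilde form)
   \<and> (\<forall>p. cohomology_isomorphic
        (fscale scale) (rb_cochains scale form) (rb_diff scale R)
        (fscale times) (cyclic_cochains scale) (cyclic_diff (descendent_mult R)) p)"
proof -
  interpret symmetric_frobenius_algebra scale form by fact
  from assms(2) obtain B where fd: "finite_dimensional_vector_space scale B" by blast
  have R: "Vector_Spaces.linear scale scale R"
    using assms(3) by (simp add: rota_baxter_operator_def)
  note iso = cochain_iso_J_tilde[OF fd assms(3,4)]
  note coh = cohomology_isomorphic_of_cochain_iso[OF vector_space_fscale[OF vector_space_axioms]
      vector_space_fscale[OF vector_space_times] iso]
  show ?thesis
    using linear_iso_on_J_map[OF fd] J_map_rb_hochschild_diff[OF assms(4)]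
      J_map_rb_diff[OF R assms(4)] linear_iso_on_J_map_cyclic[OF fd] iso coh
    by blast
qed

end
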